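(* Let $(X,p)$ and $(Y,q)$ be two quasi-normed cones and let $f:X\to Y$ be a $p$-injective linear mapping. Then the following assertions are equivalent: (i) $f$ is open and onto. (ii) There exists $\delta>0$ such that $f(\overline{B_{d_p}}(0,1))\supseteq \delta\,\overline{B_{d_q}}(0,1)$. (iii) There exists $M>0$ such that, given $y\in Y$, there is $x\in X$ with $f(x)=y$ and $p(x)\le Mq(y)$.
   Context: $\mathbb{R}^+$ is the set of nonnegative real numbers. A cone (on $\mathbb{R}^+$) is a triple $(X,+,\cdot)$ such that $(X,+)$ is an abelian monoid with neutral element $0$ and $\cdot:\mathbb{R}^+\times X\to X$ satisfies, for all $x,y\in X$ and $r,s\in\mathbb{R}^+$: $r\cdot(s\cdot x)=(rs)\cdot x$; $r\cdot(x+y)=r\cdot x+r\cdot y$; $(r+s)\cdot x=r\cdot x+s\cdot x$; $1\cdot x=x$; $0\cdot x=0$. It is cancellative if $z+x=z+y$ implies $x=y$. A linear mapping between cones is a mapping $f$ with $f(\alpha\cdot x+\beta\cdot y)=\alpha\cdot f(x)+\beta\cdot f(y)$ for all $x,y$ and $\alpha,\beta\in\mathbb{R}^+$. $-x$ denotes the additive inverse of $x$ when it exists. A quasi-norm on a cone $X$ is a function $q:X\to\mathbb{R}^+$ such that for all $x,y\in X$, $r\in\mathbb{R}^+$: (i) $x=0$ if and only if there is $-x\in X$ and $q(x)=q(-x)=0$; (ii) $q(r\cdot x)=rq(x)$; (iii) $q(x+y)\le q(x)+q(y)$. A quasi-normed cone is a pair $(X,p)$ where $X$ is a cancellative cone and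 $p$ is a quasi-norm on $X$. Its induced extended quasi-metric is $d_p(x,y)=p(a)$ if $y=x+a$ with $a\in X$, and $d_p(x,y)=+\infty$ if $y\notin x+X$. $\mathcal{T}(d_p)$ is the topology on $X$ with base the balls $B_{d_p}(x,r)=\{y\in X: d_p(x,y)<r\}$, $x\in X$, $r>0$. Put $\overline{B_{d_p}}(x,r)=\{y\in X: d_p(x,y)\le r\}$; in particular $\overline{B_{d_p}}(0,1)=\{y\in X: p(y)\le 1\}$. For $\delta>0$ and a subset $A$ of a cone, $\delta A=\{\delta\cdot a: a\in A\}$. "Open" means open as a mapping from $(X,\mathcal{T}(d_p))$ to $(Y,\mathcal{T}(d_q))$. A mapping $f$ defined on a quasi-normed cone $(X,p)$ is $p$-injective if $f(x)=f(y)$ implies $p(x)=p(y)$ for all $x,y\in X$. *)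

theory Defs
  imports "HOL-Analysis.Abstract_Topology" "HOL-Library.Extended_Real" "HOL-Algebra.Module"
begin

text \<open>As for modules in \<^theory>\<open>HOL-Algebra.Module\<close>, the additive structure of a cone is
  the additive part of a \<^type>\<open>module_scheme\<close>; its ring multiplication and unit are never used.
  The scalars are the nonnegative reals, so nothing is assumed about \<open>r \<odot> x\<close> for \<open>r < 0\<close>.\<close>

locale cone = abelian_monoid X for X :: "(real, 'a, 'm) module_scheme" (structure) +
  assumes smult_closed [simp, intro]: "\<lbrakk>0 \<le> r; x \<in> carrier X\<rbrakk> \<Longrightarrow> r \<odot> x \<in> carrier X"
    and smult_assoc: "\<lbrakk>0 \<le> r; 0 \<le> s; x \<in> carrier X\<rbrakk> \<Longrightarrow> r \<odot> (s \<odot> x) = (r * s) \<odot> x"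
    and smult_r_distr:
      "\<lbrakk>0 \<le> r; x \<in> carrier X; y \<in> carrier X\<rbrakk> \<Longrightarrow> r \<odot> (x \<oplus> y) = r \<odot> x \<oplus> r \<odot> y"
    and smult_l_distr:
      "\<lbrakk>0 \<le> r; 0 \<le> s; x \<in> carrier X\<rbrakk> \<Longrightarrow> (r + s) \<odot> x = r \<odot> x \<oplus> s \<odot> x"
    and smult_one [simp]: "x \<in> carrier X \<Longrightarrow> 1 \<odot> x = x"
    and smult_zero [simp]: "x \<in> carrier X \<Longrightarrow> 0 \<odot> x = \<zero>"

locale cancellative_cone = cone +
  assumes add_cancel:
    "\<lbrakk>x \<in> carrier X; y \<in> carrier X; z \<in> carrier X; z \<oplus> x = z \<oplus> y\<rbrakk> \<Longrightarrow> x = y"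

definition quasi_norm :: "(real, 'a, 'm) module_scheme \<Rightarrow> ('a \<Rightarrow> real) \<Rightarrow> bool" where
  "quasi_norm X p \<longleftrightarrow>
    (\<forall>x\<in>carrier X. 0 \<le> p x) \<and>
    (\<forall>x\<in>carrier X. x = \<zero>\<^bsub>X\<^esub> \<longleftrightarrow> (\<exists>y\<in>carrier X. x \<oplus>\<^bsub>X\<^esub> y = \<zero>\<^bsub>X\<^esub> \<and> p x = 0 \<and> p y = 0)) \<and>
    (\<forall>x\<in>carrier X. \<forall>r\<ge>0. p (r \<odot>\<^bsub>X\<^esub> x) = r * p x) \<and>
    (\<forall>x\<in>carrier X. \<forall>y\<in>carrier X. p (x \<oplus>\<^bsub>X\<^esub> y) \<le> p x + p y)"

locale quasi_normed_cone = cancellative_cone +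
  fixes p :: "'a \<Rightarrow> real"
  assumes quasi_norm: "quasi_norm X p"

text \<open>For \<open>x, y\<close> in a cancellative cone, the \<open>a\<close> below is unique when it exists.\<close>

definition cone_dist ::
    "(real, 'a, 'm) module_scheme \<Rightarrow> ('a \<Rightarrow> real) \<Rightarrow> 'a \<Rightarrow> 'a \<Rightarrow> ereal" where
  "cone_dist X p x y =
    (if \<exists>a\<in>carrier X. y = x \<oplus>\<^bsub>X\<^esub> a
     then ereal (p (THE a. a \<in> carrier X \<and> y = x \<oplus>\<^bsub>X\<^esub> a)) else \<infinity>)"

definition cone_ball ::
    "(real, 'a, 'm) module_scheme \<Rightarrow> ('a \<Rightarrow> real) \<Rightarrow> 'a \<Rightarrow> real \<Rightarrow> 'a set" where
  "cone_ball X p x r = {y \<in> carrier X. cone_dist X p x y < ereal r}"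

definition cone_cball ::
    "(real, 'a, 'm) module_scheme \<Rightarrow> ('a \<Rightarrow> real) \<Rightarrow> 'a \<Rightarrow> real \<Rightarrow> 'a set" where
  "cone_cball X p x r = {y \<in> carrier X. cone_dist X p x y \<le> ereal r}"

definition cone_topology ::
    "(real, 'a, 'm) module_scheme \<Rightarrow> ('a \<Rightarrow> real) \<Rightarrow> 'a topology" where
  "cone_topology X p =
    topology (arbitrary union_of (\<lambda>B. \<exists>x\<in>carrier X. \<exists>r>0. B = cone_ball X p x r))"

definition cone_linear ::
    "(real, 'a, 'm) module_scheme \<Rightarrow> (real, 'b, 'n) module_scheme \<Rightarrow> ('a \<Rightarrow> 'b) \<Rightarrow> bool" where
  "cone_linear X Y f \<longleftrightarrow> f \<in> carrier X \<rightarrow> carrier Y \<and>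
    (\<forall>x\<in>carrier X. \<forall>y\<in>carrier X. \<forall>\<alpha>\<ge>0. \<forall>\<beta>\<ge>0.
      f (\<alpha> \<odot>\<^bsub>X\<^esub> x \<oplus>\<^bsub>X\<^esub> \<beta> \<odot>\<^bsub>X\<^esub> y) = \<alpha> \<odot>\<^bsub>Y\<^esub> f x \<oplus>\<^bsub>Y\<^esub> \<beta> \<odot>\<^bsub>Y\<^esub> f y)"

definition norm_injective ::
    "(real, 'a, 'm) module_scheme \<Rightarrow> ('a \<Rightarrow> real) \<Rightarrow> ('a \<Rightarrow> 'b) \<Rightarrow> bool" where
  "norm_injective X p f \<longleftrightarrow> (\<forall>x\<in>carrier X. \<forall>y\<in>carrier X. f x = f y \<longrightarrow> p x = p y)"

context quasi_normed_cone
begin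

lemma norm_nonneg: "x \<in> carrier X \<Longrightarrow> 0 \<le> p x"
  and norm_smult: "\<lbrakk>x \<in> carrier X; 0 \<le> r\<rbrakk> \<Longrightarrow> p (r \<odot> x) = r * p x"
  and norm_triangle: "\<lbrakk>x \<in> carrier X; y \<in> carrier X\<rbrakk> \<Longrightarrow> p (x \<oplus> y) \<le> p x + p y"
  using quasi_norm by (auto simp: quasi_norm_def)

lemma norm_zero: "p \<zero> = 0"
  using norm_smult[of \<zero> 0] by simp

lemma cone_dist_add:
  assumes "x \<in> carrier X" "a \<in> carrier X"
  shows "cone_dist X p x (x \<oplus> a) = ereal (p a)"
proof -
  have "(THE b. b \<in> carrier X \<and> x \<oplus> a = x \<oplus> b) = a"
    using assms add_cancel by (intro the_equality) metis+
  then show ?thesis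
    using assms by (auto simp: cone_dist_def)
qed

lemma cone_ball_eq:
  assumes "x \<in> carrier X"
  shows "cone_ball X p x r = {x \<oplus> a | a. a \<in> carrier X \<and> p a < r}"
proof -
  have "\<exists>a\<in>carrier X. y = x \<oplus> a" if "cone_dist X p x y < ereal r" for y
    using that by (auto simp: cone_dist_def split: if_splits)
  then show ?thesis
    using assms by (fastforce simp: cone_ball_def cone_dist_add)
qed

lemma cone_cball_zero: "cone_cball X p \<zero> 1 = {y \<in> carrier X. p y \<le> 1}"
proof -
  have "cone_dist X p \<zero> y = ereal (p y)" if "y \<in> carrier X" for y
    using cone_dist_add[of \<zero> y] that by simp
  then show ?thesis
    by (auto simp: cone_cball_def)
qed

lemma openin_cone_topology:
  "openin (cone_topology X p) U \<longleftrightarrow>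
    U \<subseteq> carrier X \<and> (\<forall>x\<in>U. \<exists>r>0. cone_ball X p x r \<subseteq> U)"
proof -
  define P where "P = (\<lambda>B. \<exists>x\<in>carrier X. \<exists>r>0. B = cone_ball X p x r)"
  have inner: "\<exists>r>0. cone_ball X p y r \<subseteq> cone_ball X p x s"
    if xy: "x \<in> carrier X" "y \<in> cone_ball X p x s" for x y s
  proof -
    obtain a where a: "a \<in> carrier X" "p a < s" "y = x \<oplus> a"
      using xy by (auto simp: cone_ball_eq)
    have "cone_ball X p y (s - p a) \<subseteq> cone_ball X p x s"
    proof
      fix z assume "z \<in> cone_ball X p y (s - p a)"
      then obtain b where b: "b \<in> carrier X" "p b < s - p a" "z = y \<oplus> b"
        using xy a by (auto simp: cone_ball_eq)
      then have "z = x \<oplus> (a \<oplus> b)" "p (a \<oplus> b) < s"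
        using a xy norm_triangle[of a b] by (auto simp: a_assoc)
      then show "z \<in> cone_ball X p x s"
        using a b xy by (auto simp: cone_ball_eq)
    qed
    then show ?thesis
      using a by (intro exI[of _ "s - p a"]) auto
  qed
  have centre: "x \<in> cone_ball X p x r" if "x \<in> carrier X" "r > 0" for x r
    using that norm_zero by (auto simp: cone_ball_eq intro!: exI[of _ \<zero>])
  have sub: "cone_ball X p x r \<subseteq> carrier X" for x r
    by (auto simp: cone_ball_def)
  have iff: "(arbitrary union_of P) U \<longleftrightarrow>
      U \<subseteq> carrier X \<and> (\<forall>x\<in>U. \<exists>r>0. cone_ball X p x r \<subseteq> U)" for U
  proof
    assume "(arbitrary union_of P) U"
    then obtain \<C> where \<C>: "\<And>B. B \<in> \<C> \<Longrightarrow> P B" "U = \<Union>\<C>"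
      by (auto simp: union_of_def arbitrary_def)
    show "U \<subseteq> carrier X \<and> (\<forall>x\<in>U. \<exists>r>0. cone_ball X p x r \<subseteq> U)"
    proof (intro conjI ballI)
      show "U \<subseteq> carrier X"
        using \<C> sub unfolding P_def by blast
    next
      fix y assume "y \<in> U"
      then obtain B where B: "B \<in> \<C>" "y \<in> B"
        using \<C> by auto
      then obtain x s where "x \<in> carrier X" "B = cone_ball X p x s"
        using \<C>(1)[of B] unfolding P_def by blast
      then obtain r where "r > 0" "cone_ball X p y r \<subseteq> B"
        using inner B by blast
      then show "\<exists>r>0. cone_ball X p y r \<subseteq> U"
        using B \<C> by blast
    qed
  next
    assume U: "U \<subseteq> carrier X \<and> (\<forall>x\<in>U. \<exists>r>0. cone_ball X p x r \<subseteq> U)"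
    show "(arbitrary union_of P) U"
      unfolding union_of_def arbitrary_def
    proof (intro exI conjI)
      show "{B. P B \<and> B \<subseteq> U} \<subseteq> Collect P" by auto
      have "x \<in> \<Union>{B. P B \<and> B \<subseteq> U}" if "x \<in> U" for x
      proof -
        obtain r where "r > 0" "cone_ball X p x r \<subseteq> U"
          using U \<open>x \<in> U\<close> by blast
        moreover have "x \<in> carrier X"
          using U \<open>x \<in> U\<close> by blast
        ultimately show ?thesis
          using centre[of x r] unfolding P_def by blast
      qed
      then show "\<Union>{B. P B \<and> B \<subseteq> U} = U"
        by blast
    qed auto
  qed
  have "istopology (arbitrary union_of P)"
    unfolding istopology_base_alt
  proof (intro allI impI)
    fix S T assume *: "(arbitrary union_of P) S \<and> (arbitrary union_of P) T"
    show "(arbitrary union_of P) (S \<inter> T)"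
      unfolding iff
    proof (intro conjI ballI)
      show "S \<inter> T \<subseteq> carrier X" using * by (auto simp: iff)
    next
      fix x assume x: "x \<in> S \<inter> T"
      then obtain r s where r: "r > 0" "cone_ball X p x r \<subseteq> S"
        and s: "s > 0" "cone_ball X p x s \<subseteq> T"
        using * unfolding iff by blast
      have "cone_ball X p x (min r s) \<subseteq> cone_ball X p x r \<inter> cone_ball X p x s"
        by (auto simp: cone_ball_def less_le_trans)
      then show "\<exists>t>0. cone_ball X p x t \<subseteq> S \<inter> T"
        using r s by (intro exI[of _ "min r s"]) auto
    qed
  qed
  then show ?thesis
    unfolding cone_topology_def P_def[symmetric] by (simp add: topology_inverse' iff)
qed

end

end

theory Submission
  imports Defs
begin

text \<open>For (ii) \<open>\<Longrightarrow>\<close> (iii), scaling turns (ii) into: whenever \<open>q y \<le> s\<close> with \<open>s > 0\<close>, some preimage of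
  \<open>y\<close> has \<open>p\<close>-value at most \<open>s / \<delta>\<close>. The preimage depends on \<open>s\<close>, but by \<open>p\<close>-injectivity its
  \<open>p\<close>-value does not, so one can let \<open>s\<close> tend to \<open>q y\<close>; this covers the case \<open>q y = 0\<close>, where \<open>y\<close>
  cannot be normalised. The other implications are as for linear operators between normed spaces,
  with translates \<open>x \<oplus> a\<close> in place of differences.\<close>

context quasi_normed_cone
begin

lemma cone_ball_zero: "cone_ball X p \<zero> r = {y \<in> carrier X. p y < r}"
proof -
  have "(\<exists>a. y = \<zero> \<oplus> a \<and> a \<in> carrier X \<and> p a < r) \<longleftrightarrow> y \<in> carrier X \<and> p y < r" for y
    by (metis l_zero)
  then show ?thesis
    by (simp add: cone_ball_eq)
qed

text \<open>By the triangle inequality, the slack \<open>r - p x\<close> is a valid radius around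
  each \<open>x\<close> in the ball. This supplies the open set to which openness of a mapping is
  applied.\<close>

lemma openin_cone_ball_zero: "openin (cone_topology X p) (cone_ball X p \<zero> r)"
  unfolding openin_cone_topology
proof (intro conjI ballI)
  show "cone_ball X p \<zero> r \<subseteq> carrier X"
    by (auto simp: cone_ball_def)
next
  fix x assume "x \<in> cone_ball X p \<zero> r"
  then have x: "x \<in> carrier X" "p x < r"
    by (auto simp: cone_ball_zero)
  have "cone_ball X p x (r - p x) \<subseteq> cone_ball X p \<zero> r"
  proof
    fix y assume "y \<in> cone_ball X p x (r - p x)"
    then obtain a where "a \<in> carrier X" "p a < r - p x" "y = x \<oplus> a"
      using x by (auto simp: cone_ball_eq)
    then show "y \<in> cone_ball X p \<zero> r"
      using x norm_triangle[of x a] by (auto simp: cone_ball_zero)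
  qed
  then show "\<exists>s>0. cone_ball X p x s \<subseteq> cone_ball X p \<zero> r"
    using x by (intro exI[of _ "r - p x"]) auto
qed

end

locale quasi_normed_cone_linear =
  X: quasi_normed_cone X p + Y: quasi_normed_cone Y q
  for X :: "(real, 'a, 'm) module_scheme" (structure) and p
    and Y :: "(real, 'b, 'n) module_scheme" (structure) and q +
  fixes f :: "'a \<Rightarrow> 'b"
  assumes linear: "cone_linear X Y f"
begin

lemma map_closed: "x \<in> carrier X \<Longrightarrow> f x \<in> carrier Y"
  using linear by (auto simp: cone_linear_def)

lemma map_combination:
  "\<lbrakk>x \<in> carrier X; y \<in> carrier X; 0 \<le> \<alpha>; 0 \<le> \<beta>\<rbrakk> \<Longrightarrow>
    f (\<alpha> \<odot>\<^bsub>X\<^esub> x \<oplus>\<^bsub>X\<^esub> \<beta> \<odot>\<^bsub>X\<^esub> y) = \<alpha> \<odot>\<^bsub>Y\<^esub> f x \<oplus>\<^bsub>Y\<^esub> \<beta> \<odot>\<^bsub>Y\<^esub> f y"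
  using linear by (auto simp: cone_linear_def)

lemma map_add: "\<lbrakk>x \<in> carrier X; y \<in> carrier X\<rbrakk> \<Longrightarrow> f (x \<oplus>\<^bsub>X\<^esub> y) = f x \<oplus>\<^bsub>Y\<^esub> f y"
  using map_combination[of x y 1 1] by (simp add: map_closed)

lemma map_smult: "\<lbrakk>x \<in> carrier X; 0 \<le> r\<rbrakk> \<Longrightarrow> f (r \<odot>\<^bsub>X\<^esub> x) = r \<odot>\<^bsub>Y\<^esub> f x"
  using map_combination[of x x r 0] by (simp add: map_closed)

lemma map_zero: "f \<zero>\<^bsub>X\<^esub> = \<zero>\<^bsub>Y\<^esub>"
  using map_smult[of "\<zero>\<^bsub>X\<^esub>" 0] by (simp add: map_closed)

text \<open>The image of the open unit ball is open and contains zero, so it contains some ball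
  around zero; homogeneity of \<open>q\<close> shrinks the closed unit ball of \<open>Y\<close> into
  that one.\<close>

lemma open_map_imp_cball_subset:
  assumes "open_map (cone_topology X p) (cone_topology Y q) f"
  shows "\<exists>\<delta>>0. (\<lambda>y. \<delta> \<odot>\<^bsub>Y\<^esub> y) ` cone_cball Y q \<zero>\<^bsub>Y\<^esub> 1 \<subseteq> f ` cone_cball X p \<zero>\<^bsub>X\<^esub> 1"
proof -
  let ?U = "f ` cone_ball X p \<zero>\<^bsub>X\<^esub> 1"
  have "openin (cone_topology Y q) ?U"
    using assms X.openin_cone_ball_zero by (simp add: open_map_def)
  moreover have "\<zero>\<^bsub>Y\<^esub> \<in> ?U"
    by (rule image_eqI[of _ _ "\<zero>\<^bsub>X\<^esub>"]) (auto simp: map_zero X.cone_ball_zero X.norm_zero)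
  ultimately obtain r where r: "r > 0" "cone_ball Y q \<zero>\<^bsub>Y\<^esub> r \<subseteq> ?U"
    by (auto simp: Y.openin_cone_topology)
  \<comment> \<open>Scaling by \<open>r\<close> would only give norm \<le> \<open>r\<close>, while
    the ball inside \<open>?U\<close> is open; halving makes the bound strict.\<close>
  have "(r / 2) \<odot>\<^bsub>Y\<^esub> y \<in> f ` cone_cball X p \<zero>\<^bsub>X\<^esub> 1" if "y \<in> cone_cball Y q \<zero>\<^bsub>Y\<^esub> 1" for y
  proof -
    have y: "y \<in> carrier Y" "q y \<le> 1"
      using that by (auto simp: Y.cone_cball_zero)
    then have "r * q y \<le> r * 1"
      using r(1) by (intro mult_left_mono) auto
    then have "q ((r / 2) \<odot>\<^bsub>Y\<^esub> y) < r"
      using y r(1) by (simp add: Y.norm_smult)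
    then have "(r / 2) \<odot>\<^bsub>Y\<^esub> y \<in> cone_ball Y q \<zero>\<^bsub>Y\<^esub> r"
      using y r(1) by (auto simp: Y.cone_ball_zero)
    moreover have "cone_ball X p \<zero>\<^bsub>X\<^esub> 1 \<subseteq> cone_cball X p \<zero>\<^bsub>X\<^esub> 1"
      by (auto simp: cone_ball_def cone_cball_def)
    ultimately show ?thesis
      using r(2) by blast
  qed
  then show ?thesis
    using r(1) by (intro exI[of _ "r / 2"]) auto
qed

lemma cball_subset_imp_bounded_preimage:
  assumes inj: "norm_injective X p f" and "\<delta> > 0"
    and sub: "(\<lambda>y. \<delta> \<odot>\<^bsub>Y\<^esub> y) ` cone_cball Y q \<zero>\<^bsub>Y\<^esub> 1 \<subseteq> f ` cone_cball X p \<zero>\<^bsub>X\<^esub> 1"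
    and y: "y \<in> carrier Y"
  shows "\<exists>x\<in>carrier X. f x = y \<and> p x \<le> (1 / \<delta>) * q y"
proof -
  have scaled: "\<exists>x\<in>carrier X. f x = y \<and> p x \<le> s / \<delta>" if s: "s > 0" "q y \<le> s" for s
  proof -
    have "(1 / s) \<odot>\<^bsub>Y\<^esub> y \<in> cone_cball Y q \<zero>\<^bsub>Y\<^esub> 1"
      using s y by (simp add: Y.cone_cball_zero Y.norm_smult)
    then obtain x where x: "x \<in> carrier X" "p x \<le> 1" "f x = \<delta> \<odot>\<^bsub>Y\<^esub> ((1 / s) \<odot>\<^bsub>Y\<^esub> y)"
      using sub by (force simp: X.cone_cball_zero)
    \<comment> \<open>The factor \<open>s / \<delta>\<close> undoes both scalings:
      \<open>(s / \<delta>) * \<delta> * (1 / s) = 1\<close>.\<close>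
    have "f ((s / \<delta>) \<odot>\<^bsub>X\<^esub> x) = y"
      using x s y \<open>\<delta> > 0\<close> by (simp add: map_smult Y.smult_assoc)
    moreover have "s / \<delta> * p x \<le> s / \<delta> * 1"
      using x s \<open>\<delta> > 0\<close> by (intro mult_left_mono) auto
    then have "p ((s / \<delta>) \<odot>\<^bsub>X\<^esub> x) \<le> s / \<delta>"
      using x s \<open>\<delta> > 0\<close> by (simp add: X.norm_smult)
    ultimately show ?thesis
      using x s \<open>\<delta> > 0\<close> by (intro bexI[of _ "(s / \<delta>) \<odot>\<^bsub>X\<^esub> x"]) auto
  qed
  have "q y \<ge> 0"
    using y by (rule Y.norm_nonneg)
  \<comment> \<open>Adding 1 makes the scale positive even when \<open>q y = 0\<close>. Only the
    existence of a preimage is kept; the crude bound on \<open>p x\<close> is improved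
    below.\<close>
  then obtain x where x: "x \<in> carrier X" "f x = y"
    using scaled[of "q y + 1"] by auto
  \<comment> \<open>Multiplying through by \<open>\<delta>\<close> leaves \<open>e\<close> itself as
    the error term. The preimage \<open>x'\<close> found for \<open>e\<close> varies with it, but
    its bound passes to the fixed \<open>x\<close> because \<open>p x = p x'\<close>.\<close>
  have "\<delta> * p x \<le> q y + e" if "e > 0" for e
  proof -
    have "q y + e > 0" "q y \<le> q y + e"
      using \<open>q y \<ge> 0\<close> that by auto
    then obtain x' where "x' \<in> carrier X" "f x' = y" "p x' \<le> (q y + e) / \<delta>"
      using scaled by blast
    moreover from this have "p x = p x'"
      using inj x unfolding norm_injective_def by blast
    ultimately show ?thesis
      using \<open>\<delta> > 0\<close> by (simp add: field_simps)
  qed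
  then have "\<delta> * p x \<le> q y"
    by (rule field_le_epsilon)
  then show ?thesis
    using x \<open>\<delta> > 0\<close> by (intro bexI[of _ x]) (auto simp: field_simps)
qed

context
  fixes M :: real
  assumes M: "M > 0" "\<And>y. y \<in> carrier Y \<Longrightarrow> \<exists>x\<in>carrier X. f x = y \<and> p x \<le> M * q y"
begin

lemma bounded_preimage_imp_onto: "f ` carrier X = carrier Y"
  using M(2) map_closed by blast

text \<open>Points near \<open>f x\<close> are translates of \<open>f x\<close> by some
  \<open>b\<close> with small \<open>q b\<close>. Lifting \<open>b\<close> to a preimage
  \<open>a\<close> with \<open>p a\<close> controlled by \<open>M * q b\<close> gives the preimage
  \<open>x + a\<close>, which is near \<open>x\<close>.\<close>

lemma bounded_preimage_imp_open_map:
  "open_map (cone_topology X p) (cone_topology Y q) f"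
  unfolding open_map_def
proof (intro allI impI)
  fix U assume "openin (cone_topology X p) U"
  then have U: "U \<subseteq> carrier X" "\<And>x. x \<in> U \<Longrightarrow> \<exists>r>0. cone_ball X p x r \<subseteq> U"
    by (auto simp: X.openin_cone_topology)
  show "openin (cone_topology Y q) (f ` U)"
    unfolding Y.openin_cone_topology
  proof (intro conjI ballI)
    show "f ` U \<subseteq> carrier Y"
      using U(1) map_closed by blast
  next
    fix y assume "y \<in> f ` U"
    then obtain x where x: "x \<in> U" "x \<in> carrier X" "y = f x"
      using U(1) by blast
    then obtain r where r: "r > 0" "cone_ball X p x r \<subseteq> U"
      using U(2) by blast
    \<comment> \<open>The radius \<open>r / M\<close> is chosen so that \<open>q b < r / M\<close>
      forces \<open>p a \<le> M * q b < r\<close>.\<close>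
    have "cone_ball Y q y (r / M) \<subseteq> f ` U"
    proof
      fix z assume "z \<in> cone_ball Y q y (r / M)"
      then obtain b where b: "b \<in> carrier Y" "q b < r / M" "z = f x \<oplus>\<^bsub>Y\<^esub> b"
        using x by (auto simp: Y.cone_ball_eq map_closed)
      obtain a where a: "a \<in> carrier X" "f a = b" "p a \<le> M * q b"
        using M(2) b(1) by blast
      have "p a < r"
        using a(3) b(2) M(1) by (simp add: field_simps)
      then have "x \<oplus>\<^bsub>X\<^esub> a \<in> U"
        using r(2) a x by (auto simp: X.cone_ball_eq)
      moreover have "z = f (x \<oplus>\<^bsub>X\<^esub> a)"
        using a b x by (simp add: map_add)
      ultimately show "z \<in> f ` U"
        by blast
    qed
    then show "\<exists>r>0. cone_ball Y q y r \<subseteq> f ` U"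
      using r(1) M(1) by (intro exI[of _ "r / M"]) auto
  qed
qed

end

end

theorem theorem27:
  fixes X :: "(real, 'a, 'm) module_scheme"
    and Y :: "(real, 'b, 'n) module_scheme"
    and p :: "'a \<Rightarrow> real" and q :: "'b \<Rightarrow> real" and f :: "'a \<Rightarrow> 'b"
  assumes "quasi_normed_cone X p" and "quasi_normed_cone Y q"
    and "cone_linear X Y f" and "norm_injective X p f"
  shows
    "(open_map (cone_topology X p) (cone_topology Y q) f \<and> f ` carrier X = carrier Y \<longleftrightarrow>
       (\<exists>\<delta>>0. (\<lambda>y. \<delta> \<odot>\<^bsub>Y\<^esub> y) ` cone_cball Y q \<zero>\<^bsub>Y\<^esub> 1 \<subseteq> f ` cone_cball X p \<zero>\<^bsub>X\<^esub> 1)) \<and>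
     ((\<exists>\<delta>>0. (\<lambda>y. \<delta> \<odot>\<^bsub>Y\<^esub> y) ` cone_cball Y q \<zero>\<^bsub>Y\<^esub> 1 \<subseteq> f ` cone_cball X p \<zero>\<^bsub>X\<^esub> 1) \<longleftrightarrow>
       (\<exists>M>0. \<forall>y\<in>carrier Y. \<exists>x\<in>carrier X. f x = y \<and> p x \<le> M * q y))"
proof -
  interpret quasi_normed_cone_linear X p Y q f
    using assms by (simp add: quasi_normed_cone_linear_def quasi_normed_cone_linear_axioms_def)
  let ?i = "open_map (cone_topology X p) (cone_topology Y q) f \<and> f ` carrier X = carrier Y"
  let ?ii = "\<exists>\<delta>>0. (\<lambda>y. \<delta> \<odot>\<^bsub>Y\<^esub> y) ` cone_cball Y q \<zero>\<^bsub>Y\<^esub> 1 \<subseteq> f ` cone_cball X p \<zero>\<^bsub>X\<^esub> 1"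
  let ?iii = "\<exists>M>0. \<forall>y\<in>carrier Y. \<exists>x\<in>carrier X. f x = y \<and> p x \<le> M * q y"
  \<comment> \<open>The implications are proved in a cycle, from which both equivalences follow
    propositionally; (ii) gives (iii) with \<open>M = 1 / \<delta>\<close>.\<close>
  have "?i \<Longrightarrow> ?ii"
    using open_map_imp_cball_subset by blast
  moreover have ?iii if ?ii
  proof -
    from that
    obtain \<delta> where "\<delta> > 0" "(\<lambda>y. \<delta> \<odot>\<^bsub>Y\<^esub> y) ` cone_cball Y q \<zero>\<^bsub>Y\<^esub> 1 \<subseteq> f ` cone_cball X p \<zero>\<^bsub>X\<^esub> 1"
      by blast
    then show ?iii
      using cball_subset_imp_bounded_preimage[OF assms(4)] by (intro exI[of _ "1 / \<delta>"]) simp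
  qed
  moreover have ?i if ?iii
  proof -
    from that obtain M where "M > 0" "\<And>y. y \<in> carrier Y \<Longrightarrow> \<exists>x\<in>carrier X. f x = y \<and> p x \<le> M * q y"
      by blast
    then show ?i
      by (intro conjI bounded_preimage_imp_open_map bounded_preimage_imp_onto)
  qed
  ultimately show ?thesis
    by argo
qed

end
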